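(* There is a rooted graph $(G, S)$ such that $G$ has exactly $21$ vertices, $\mu(G, S)=1$ and $\tau(G, S)\ge 4$.
   Context: Graphs are finite and may have loops and multiple edges (a loop is a cycle of length $1$, and two parallel edges form a cycle of length $2$). A rooted graph is a pair $(G,S)$ of a graph $G$ and a vertex set $S\subseteq V(G)$. An $S$-cycle is a cycle of $G$ that contains a vertex of $S$. A vertex set $T\subseteq V(G)$ is an $S$-cycle hitting set if $T$ meets every $S$-cycle of $G$. $\mu(G,S)$ denotes the maximum number of pairwise vertex-disjoint $S$-cycles in $(G,S)$, and $\tau(G,S)$ denotes the minimum size of an $S$-cycle hitting set in $(G,S)$. *)

theory Defs
  imports Main
begin

text \<open>An edge is an identifier, so parallel edges are different identifiers with the same
  end set, and a loop is an edge whose end set is a singleton.\<close>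

record ('v, 'e) multigraph =
  verts :: "'v set"
  edges :: "'e set"
  ends :: "'e \<Rightarrow> 'v set"

definition finite_multigraph :: "('v, 'e) multigraph \<Rightarrow> bool" where
  "finite_multigraph G \<longleftrightarrow> finite (verts G) \<and> finite (edges G) \<and>
     (\<forall>e \<in> edges G. \<exists>u \<in> verts G. \<exists>v \<in> verts G. ends G e = {u, v})"

definition rooted_graph :: "('v, 'e) multigraph \<Rightarrow> 'v set \<Rightarrow> bool" where
  "rooted_graph G S \<longleftrightarrow> finite_multigraph G \<and> S \<subseteq> verts G"

text \<open>A cycle is given by its cyclic sequences of vertices and edges, the \<open>i\<close>-th edge joining
  the \<open>i\<close>-th vertex to its cyclic successor. Distinctness of the edges matters only for
  length 2, where it excludes traversing a single edge back and forth. Rotations and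
  reflections of a cycle are different pairs of lists, but they share their vertices, so a
  family of vertex-disjoint cycles contains at most one of them.\<close>

definition is_cycle :: "('v, 'e) multigraph \<Rightarrow> 'v list \<times> 'e list \<Rightarrow> bool" where
  "is_cycle G C \<longleftrightarrow> (case C of (vs, es) \<Rightarrow>
     vs \<noteq> [] \<and> length es = length vs \<and> distinct vs \<and> distinct es \<and>
     set vs \<subseteq> verts G \<and> set es \<subseteq> edges G \<and>
     (\<forall>i < length vs. ends G (es ! i) = {vs ! i, vs ! (Suc i mod length vs)}))"

definition cycle_verts :: "'v list \<times> 'e list \<Rightarrow> 'v set" where
  "cycle_verts C = set (fst C)"

definition is_S_cycle :: "('v, 'e) multigraph \<Rightarrow> 'v set \<Rightarrow> 'v list \<times> 'e list \<Rightarrow> bool" where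
  "is_S_cycle G S C \<longleftrightarrow> is_cycle G C \<and> cycle_verts C \<inter> S \<noteq> {}"

definition S_cycle_packing ::
  "('v, 'e) multigraph \<Rightarrow> 'v set \<Rightarrow> ('v list \<times> 'e list) set \<Rightarrow> bool" where
  "S_cycle_packing G S P \<longleftrightarrow> finite P \<and> (\<forall>C \<in> P. is_S_cycle G S C) \<and>
     (\<forall>C \<in> P. \<forall>D \<in> P. C \<noteq> D \<longrightarrow> cycle_verts C \<inter> cycle_verts D = {})"

definition S_cycle_hitting_set :: "('v, 'e) multigraph \<Rightarrow> 'v set \<Rightarrow> 'v set \<Rightarrow> bool" where
  "S_cycle_hitting_set G S T \<longleftrightarrow> T \<subseteq> verts G \<and>
     (\<forall>C. is_S_cycle G S C \<longrightarrow> T \<inter> cycle_verts C \<noteq> {})"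

definition mu :: "('v, 'e) multigraph \<Rightarrow> 'v set \<Rightarrow> nat" where
  "mu G S = Max {card P | P. S_cycle_packing G S P}"

definition tau :: "('v, 'e) multigraph \<Rightarrow> 'v set \<Rightarrow> nat" where
  "tau G S = Min {card T | T. S_cycle_hitting_set G S T}"

text \<open>\<open>Max\<close> and \<open>Min\<close> above range over finite nonempty sets.\<close>

lemma card_S_cycle_packing_le:
  assumes "finite (verts G)" "S_cycle_packing G S P"
  shows "card P \<le> card (verts G)"
proof -
  have sub: "cycle_verts C \<subseteq> verts G" and ne: "cycle_verts C \<noteq> {}" if "C \<in> P" for C
  proof -
    have "is_cycle G C" using assms(2) that by (auto simp: S_cycle_packing_def is_S_cycle_def)
    then show "cycle_verts C \<subseteq> verts G" "cycle_verts C \<noteq> {}"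
      by (cases C; simp add: is_cycle_def cycle_verts_def)+
  qed
  define f where "f C = (SOME v. v \<in> cycle_verts C)" for C :: "'a list \<times> 'b list"
  have f: "f C \<in> cycle_verts C" if "C \<in> P" for C
    using ne[OF that] by (auto simp: f_def intro: someI_ex)
  have "inj_on f P"
  proof (rule inj_onI)
    fix C D assume CD: "C \<in> P" "D \<in> P" "f C = f D"
    then have "f C \<in> cycle_verts C \<inter> cycle_verts D" using f by fastforce
    then show "C = D" using assms(2) CD unfolding S_cycle_packing_def by blast
  qed
  moreover have "f ` P \<subseteq> verts G" using f sub by blast
  ultimately show ?thesis using assms(1) by (rule card_inj_on_le)
qed

lemma mu_range:
  assumes "finite (verts G)"
  shows "finite {card P | P. S_cycle_packing G S P}" "{card P | P. S_cycle_packing G S P} \<noteq> {}"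
proof -
  have "{card P | P. S_cycle_packing G S P} \<subseteq> {..card (verts G)}"
    using card_S_cycle_packing_le[OF assms] by blast
  then show "finite {card P | P. S_cycle_packing G S P}" using finite_subset by blast
  have "S_cycle_packing G S {}" by (simp add: S_cycle_packing_def)
  then show "{card P | P. S_cycle_packing G S P} \<noteq> {}" by blast
qed

lemma tau_range:
  assumes "finite (verts G)"
  shows "finite {card T | T. S_cycle_hitting_set G S T}"
    "{card T | T. S_cycle_hitting_set G S T} \<noteq> {}"
proof -
  have "{card T | T. S_cycle_hitting_set G S T} \<subseteq> {..card (verts G)}"
    using card_mono[OF assms] by (auto simp: S_cycle_hitting_set_def)
  then show "finite {card T | T. S_cycle_hitting_set G S T}" using finite_subset by blast
  have "S_cycle_hitting_set G S (verts G)"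
    by (auto simp: S_cycle_hitting_set_def is_S_cycle_def is_cycle_def cycle_verts_def)
  then show "{card T | T. S_cycle_hitting_set G S T} \<noteq> {}" by blast
qed

end

theory Submission
  imports Defs
begin

text \<open>
  The example is an inflation of $K_{3,3}$. Take $K_{3,3}$ as a hexagon with nodes
  $0, \dots, 5$ and its three long diagonals. Replace every node by a triangle, so that the three
  edges at the node leave from the three corners. A diagonal is then shrunk to a single vertex,
  shared by the triangles at its two ends, while every hexagon edge is subdivided by one vertex;
  these six subdividing vertices form \<open>S\<close>. The result has $12 + 3 + 6 = 21$ vertices.

  A rooted cycle passes through a triangle, if it leaves it at all, by two of its three
  corners. Hence it traces a nonempty \<open>2\<close>-regular subgraph of $K_{3,3}$. The small triangles
  themselves are not rooted, so no rooted cycle escapes this description.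
  In $K_{3,3}$ any two cycles share a node, since each of them has at least two of the three nodes
  of either colour class. At a shared node both rooted cycles use two of the same three corners, so
  they meet in the graph as well. Both steps are the remark that two majorities of three things
  intersect (\<open>two_of_two_of\<close>); the count of nodes is \<open>S_cycle_passes_two_even_nodes\<close>.

  On the other hand every vertex of the graph lies on, or at an end of, exactly one edge
  of $K_{3,3}$, and deleting it does no more harm than deleting that edge. Three vertices
  thus destroy at most three of the nine edges. The six edges that remain on six nodes contain a
  cycle of $K_{3,3}$, and since no cycle consists of diagonals only, its lift is a rooted
  cycle that avoids the three vertices (\<open>K33_minus_three_edges\<close>, \<open>lift_cycle_S_cycle\<close>).
  Inflating the nodes is what makes vertices of the graph as weak as edges of $K_{3,3}$: in
  $K_{3,3}$ itself two vertices already meet all cycles.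
\<close>

section \<open>The inflated $K_{3,3}$\<close>

text \<open>
  The corners of the triangle at node \<open>i\<close> are \<open>3 * i\<close> (towards node \<open>i - 1\<close>), \<open>3 * i + 1\<close>
  (towards node \<open>i + 1\<close>) and \<open>18 + i mod 3\<close> (the diagonal, shared with node \<open>i + 3\<close>); the
  vertex subdividing the hexagon edge from \<open>i\<close> to \<open>i + 1\<close> is \<open>3 * i + 2\<close>. Thus the vertices below
  \<open>18\<close> form a ring in their numerical order, with edge \<open>e\<close> leading from \<open>e\<close> to its successor, and
  the edges \<open>18 + 2 * i\<close> and \<open>19 + 2 * i\<close> join the two ring corners of node \<open>i\<close> to its diagonal.
\<close>

definition ends_of :: "nat \<Rightarrow> nat set" where
  "ends_of e = (if e < 18 then {e, Suc e mod 18}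
     else {3 * ((e - 18) div 2) + e mod 2, 18 + (e - 18) div 2 mod 3})"

definition inflated_K33 :: "(nat, nat) multigraph" where
  "inflated_K33 = \<lparr>verts = {..<21}, edges = {..<30}, ends = ends_of\<rparr>"

definition ring_roots :: "nat set" where
  "ring_roots = {2, 5, 8, 11, 14, 17}"

lemma inflated_K33_simps [simp]:
  "verts inflated_K33 = {..<21}" "edges inflated_K33 = {..<30}" "ends inflated_K33 = ends_of"
  by (simp_all add: inflated_K33_def)

lemma ends_of_less:
  assumes "e < 30"
  shows "ends_of e \<subseteq> {..<21}" "card (ends_of e) = 2"
proof -
  have "\<forall>e \<in> set [0..<30]. (\<forall>v \<in> ends_of e. v < 21) \<and> card (ends_of e) = 2"
    by code_simp
  then show "ends_of e \<subseteq> {..<21}" "card (ends_of e) = 2"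
    using assms by auto
qed

lemma rooted_graph_inflated_K33: "rooted_graph inflated_K33 ring_roots"
proof -
  have "\<exists>u \<in> {..<21}. \<exists>v \<in> {..<21}. ends_of e = {u, v}" if "e < 30" for e
    using ends_of_less[OF that] by (auto simp: card_2_iff)
  then show ?thesis
    by (auto simp: rooted_graph_def finite_multigraph_def ring_roots_def)
qed

section \<open>Degrees along a cycle\<close>

lemma cycle_ends_subset:
  assumes "is_cycle G (vs, es)" "e \<in> set es"
  shows "ends G e \<subseteq> set vs"
proof -
  obtain i where i: "i < length vs" "e = es ! i"
    using assms by (auto simp: is_cycle_def in_set_conv_nth)
  then have "ends G e = {vs ! i, vs ! (Suc i mod length vs)}"
    using assms by (auto simp: is_cycle_def)
  moreover have "Suc i mod length vs < length vs"
    using i by (intro mod_less_divisor) auto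
  ultimately show ?thesis
    using i by auto
qed

text \<open>
  All that the argument for disjoint cycles needs from the edge sequence of a cycle: its edge set
  has degree \<open>2\<close> at the vertices of the cycle and \<open>0\<close> elsewhere. Without loops the cycle has length
  at least \<open>2\<close>, so the two edges at a vertex have different positions and are distinct.
\<close>

lemma cycle_degree:
  assumes cyc: "is_cycle G (vs, es)"
    and loopless: "\<And>e. e \<in> edges G \<Longrightarrow> card (ends G e) = 2"
  shows "card {e \<in> set es. v \<in> ends G e} = (if v \<in> set vs then 2 else 0)"
proof (cases "v \<in> set vs")
  case False
  then have "{e \<in> set es. v \<in> ends G e} = {}"
    using cycle_ends_subset[OF cyc] by auto
  then show ?thesis using False by simp
next
  case True
  let ?n = "length vs"
  have len: "length es = ?n" and dv: "distinct vs" and de: "distinct es"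
    and "set es \<subseteq> edges G"
    and ends: "\<And>i. i < ?n \<Longrightarrow> ends G (es ! i) = {vs ! i, vs ! (Suc i mod ?n)}"
    using cyc by (auto simp: is_cycle_def)
  obtain k where k: "k < ?n" "v = vs ! k"
    using True by (auto simp: in_set_conv_nth)
  have "card (ends G (es ! k)) = 2"
    using loopless \<open>set es \<subseteq> edges G\<close> k(1) len by (metis nth_mem subsetD)
  then have n: "?n \<ge> 2"
    using ends[OF k(1)] k by (cases "?n = 1") auto
  \<comment> \<open>the cyclic predecessor of position \<open>k\<close>\<close>
  define p where "p = (if k = 0 then ?n - 1 else k - 1)"
  have p: "p < ?n" "p \<noteq> k"
    using k n by (auto simp: p_def)
  have succ: "Suc i mod ?n = k \<longleftrightarrow> i = p" if "i < ?n" for i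
    using that k n by (cases "Suc i = ?n") (auto simp: p_def)
  have inc: "v \<in> ends G (es ! i) \<longleftrightarrow> i = k \<or> i = p" if "i < ?n" for i
  proof -
    have "Suc i mod ?n < ?n"
      using that by (intro mod_less_divisor) auto
    then show ?thesis
      using that k dv succ[OF that] by (auto simp: ends[OF that] nth_eq_iff_index_eq)
  qed
  have "{e \<in> set es. v \<in> ends G e} = {es ! k, es ! p}"
    using inc k(1) p(1) len by (auto simp: in_set_conv_nth)
  moreover have "es ! k \<noteq> es ! p"
    using de k(1) p len by (simp add: nth_eq_iff_index_eq)
  ultimately show ?thesis using True by simp
qed

section \<open>Two rooted cycles meet\<close>

definition two_of :: "bool \<Rightarrow> bool \<Rightarrow> bool \<Rightarrow> bool" where
  "two_of p q r \<longleftrightarrow> p \<and> q \<or> p \<and> r \<or> q \<and> r"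

lemma two_of_two_of:
  assumes "two_of p q r" "two_of p' q' r'"
  shows "p \<and> p' \<or> q \<and> q' \<or> r \<and> r'"
  using assms by (auto simp: two_of_def)

text \<open>
  A cycle that enters and leaves the triangle of a node uses two of its corners, be it
  directly or by way of the third one.
\<close>

definition passes :: "nat set \<Rightarrow> nat \<Rightarrow> bool" where
  "passes V i \<longleftrightarrow> two_of (3 * i \<in> V) (3 * i + 1 \<in> V) (18 + i mod 3 \<in> V)"

lemma passes_disjoint:
  assumes "passes V i" "passes W i"
  shows "V \<inter> W \<noteq> {}"
  using two_of_two_of[OF assms[unfolded passes_def]] by blast

text \<open>
  The edges at the four kinds of vertices. On the ring the edge before \<open>3 * i\<close> is
  \<open>3 * i - 1\<close> modulo \<open>18\<close>, and the diagonal of \<open>i\<close> takes two edges from node \<open>i mod 3\<close> and two from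
  node \<open>i mod 3 + 3\<close>.
\<close>

lemma incident_edges:
  assumes "i < 6"
  shows "{e \<in> {..<30}. 3 * i \<in> ends_of e} = {3 * i, (3 * i + 17) mod 18, 18 + 2 * i}"
    and "{e \<in> {..<30}. 3 * i + 1 \<in> ends_of e} = {3 * i, 3 * i + 1, 19 + 2 * i}"
    and "{e \<in> {..<30}. 3 * i + 2 \<in> ends_of e} = {3 * i + 1, 3 * i + 2}"
    and "{e \<in> {..<30}. 18 + i mod 3 \<in> ends_of e} =
      (\<lambda>j. 18 + 2 * (i mod 3) + j) ` {0, 1, 6, 7}"
proof -
  have *: "{e \<in> {..<30}. P e} = set (filter P [0..<30])" for P :: "nat \<Rightarrow> bool"
    by auto
  have "\<forall>i \<in> set [0..<6].
      set (filter (\<lambda>e. 3 * i \<in> ends_of e) [0..<30])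
        = {3 * i, (3 * i + 17) mod 18, 18 + 2 * i} \<and>
      set (filter (\<lambda>e. 3 * i + 1 \<in> ends_of e) [0..<30])
        = {3 * i, 3 * i + 1, 19 + 2 * i} \<and>
      set (filter (\<lambda>e. 3 * i + 2 \<in> ends_of e) [0..<30])
        = {3 * i + 1, 3 * i + 2} \<and>
      set (filter (\<lambda>e. 18 + i mod 3 \<in> ends_of e) [0..<30])
        = (\<lambda>j. 18 + 2 * (i mod 3) + j) ` {0, 1, 6, 7}"
    by code_simp
  then show "{e \<in> {..<30}. 3 * i \<in> ends_of e} = {3 * i, (3 * i + 17) mod 18, 18 + 2 * i}"
    and "{e \<in> {..<30}. 3 * i + 1 \<in> ends_of e} = {3 * i, 3 * i + 1, 19 + 2 * i}"
    and "{e \<in> {..<30}. 3 * i + 2 \<in> ends_of e} = {3 * i + 1, 3 * i + 2}"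
    and "{e \<in> {..<30}. 18 + i mod 3 \<in> ends_of e} =
      (\<lambda>j. 18 + 2 * (i mod 3) + j) ` {0, 1, 6, 7}"
    using assms unfolding * by simp_all
qed

text \<open>
  Conservation at a triangle with ring corners of degree \<open>3\<close>: \<open>m\<close> is the edge between
  them, \<open>p\<close> and \<open>q\<close> lead along the hexagon, \<open>x\<close> and \<open>y\<close> lead to the diagonal corner. Adding the
  degrees of the two ring corners counts \<open>m\<close> twice, so the other four edges occur in even number.
  \<open>L\<close>, \<open>R\<close> and \<open>K\<close> say that the left, right and diagonal corner are on the cycle.
\<close>

lemma triangle_transit:
  assumes "distinct [m, p, x]" "distinct [m, q, y]"
    and "card ({m, p, x} \<inter> E) = (if L then 2 else 0)"
    and "card ({m, q, y} \<inter> E) = (if R then 2 else 0)"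
  shows "((p \<in> E) \<noteq> (q \<in> E)) = ((x \<in> E) \<noteq> (y \<in> E))"
    and "p \<in> E \<or> q \<in> E \<Longrightarrow> x \<in> E \<or> y \<in> E \<longrightarrow> K \<Longrightarrow> two_of L R K"
  using assms
  by (auto simp: two_of_def Int_insert_left card_insert_if split: if_splits)

text \<open>
  This is the fact that a cycle of $K_{3,3}$ has two nodes in each colour class. Let
  \<open>a i\<close> say that the cycle runs along the hexagon edge from \<open>i\<close> to \<open>i + 1\<close>, and \<open>t i\<close> that it leaves
  node \<open>i\<close> along the diagonal. Parity at the triangle of \<open>i\<close> makes \<open>t i\<close> the exclusive or of
  \<open>a (i - 1)\<close> and \<open>a i\<close>, and parity at the diagonal makes \<open>t i\<close> and \<open>t (i + 3)\<close> equal. If, say,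
  at most the even node \<open>0\<close> were passed, then \<open>a 1\<close> to \<open>a 4\<close> would be false, hence \<open>a 0\<close> and \<open>a 5\<close>
  too by the equations for the diagonals at \<open>1\<close> and at \<open>2\<close>, and the cycle would contain no root.
\<close>

lemma S_cycle_passes_two_even_nodes:
  assumes "is_S_cycle inflated_K33 ring_roots C"
  shows "two_of (passes (cycle_verts C) 0) (passes (cycle_verts C) 2) (passes (cycle_verts C) 4)"
proof -
  obtain V E where V: "cycle_verts C = V"
    and sub: "E \<subseteq> {..<30}"
    and deg: "\<And>v. card {e \<in> E. v \<in> ends_of e} = (if v \<in> V then 2 else 0)"
  proof -
    obtain vs es where C: "C = (vs, es)" by (cases C)
    have cyc: "is_cycle inflated_K33 (vs, es)"
      using assms C by (simp add: is_S_cycle_def)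
    show ?thesis
      using that[of "set vs" "set es"] cycle_degree[OF cyc] ends_of_less(2) cyc C
      by (auto simp: cycle_verts_def is_cycle_def)
  qed
  have degI: "card (I \<inter> E) = (if v \<in> V then 2 else 0)"
    if "{e \<in> {..<30}. v \<in> ends_of e} = I" for v I
  proof -
    have "I \<inter> E = {e \<in> E. v \<in> ends_of e}" using that sub by blast
    then show ?thesis using deg by simp
  qed
  define a where "a i \<longleftrightarrow> 3 * i + 2 \<in> V" for i :: nat
  define t where "t i \<longleftrightarrow> (18 + 2 * i \<in> E) \<noteq> (19 + 2 * i \<in> E)" for i :: nat
  have root: "(3 * i + 1 \<in> E \<longleftrightarrow> a i) \<and> (3 * i + 2 \<in> E \<longleftrightarrow> a i)" if "i < 6" for i
    using degI[OF incident_edges(3)[OF that]]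
    by (auto simp: a_def Int_insert_left split: if_splits)
  have six: "i \<in> {0, 1, 2, 3, 4, 5}" if "i < 6" for i :: nat
    using that by auto
  have root_before: "(3 * i + 17) mod 18 \<in> E \<longleftrightarrow> a ((i + 5) mod 6)" if "i < 6" for i
  proof -
    have "(3 * i + 17) mod 18 = 3 * ((i + 5) mod 6) + 2"
      using six[OF that] by auto
    then show ?thesis
      using root[of "(i + 5) mod 6"] by simp
  qed
  have chord: "18 + i mod 3 \<in> V" if "18 + 2 * i \<in> E \<or> 19 + 2 * i \<in> E" "i < 6" for i
  proof (rule ccontr)
    assume "18 + i mod 3 \<notin> V"
    then have "((\<lambda>j. 18 + 2 * (i mod 3) + j) ` {0, 1, 6, 7}) \<inter> E = {}"
      using degI[OF incident_edges(4)[OF that(2)]] by simp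
    then show False
      using that(1) six[OF that(2)] by auto
  qed
  have node: "(a ((i + 5) mod 6) \<noteq> a i \<longleftrightarrow> t i) \<and>
      (a ((i + 5) mod 6) \<or> a i \<longrightarrow> passes V i)" if "i < 6" for i
  proof -
    have d: "distinct [3 * i, (3 * i + 17) mod 18, 18 + 2 * i]"
      "distinct [3 * i, 3 * i + 1, 19 + 2 * i]"
      using six[OF that] by auto
    note corners = degI[OF incident_edges(1)[OF that]] degI[OF incident_edges(2)[OF that]]
    show ?thesis
      using triangle_transit(1)[OF d corners]
        triangle_transit(2)[OF d corners, where K = "18 + i mod 3 \<in> V"]
        chord[OF _ that] root[OF that] root_before[OF that]
      by (auto simp: t_def passes_def)
  qed
  have opposite: "t i \<longleftrightarrow> t (i + 3)" if "i < 3" for i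
    using degI[OF incident_edges(4)[of i]] that
    by (auto simp: t_def Int_insert_left card_insert_if algebra_simps split: if_splits)
  have nodes: "a 5 \<noteq> a 0 \<longleftrightarrow> t 0" "a 0 \<noteq> a 1 \<longleftrightarrow> t 1" "a 1 \<noteq> a 2 \<longleftrightarrow> t 2"
      "a 2 \<noteq> a 3 \<longleftrightarrow> t 3" "a 3 \<noteq> a 4 \<longleftrightarrow> t 4" "a 4 \<noteq> a 5 \<longleftrightarrow> t 5"
    using node[of 0] node[of 1] node[of 2] node[of 3] node[of 4] node[of 5] by auto
  have passing: "a 5 \<or> a 0 \<longrightarrow> passes V 0" "a 1 \<or> a 2 \<longrightarrow> passes V 2"
      "a 3 \<or> a 4 \<longrightarrow> passes V 4"
    using node[of 0] node[of 2] node[of 4] by auto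
  have "t 0 = t 3" "t 1 = t 4" "t 2 = t 5"
    using opposite[of 0] opposite[of 1] opposite[of 2] by simp_all
  moreover have "a 0 \<or> a 1 \<or> a 2 \<or> a 3 \<or> a 4 \<or> a 5"
    using assms V by (auto simp: is_S_cycle_def ring_roots_def a_def numeral_2_eq_2)
  ultimately show ?thesis
    unfolding V two_of_def using nodes passing by argo
qed

lemma S_cycles_intersect:
  assumes "is_S_cycle inflated_K33 ring_roots C" "is_S_cycle inflated_K33 ring_roots D"
  shows "cycle_verts C \<inter> cycle_verts D \<noteq> {}"
  using two_of_two_of[OF assms[THEN S_cycle_passes_two_even_nodes]] passes_disjoint by blast

section \<open>No three vertices meet all rooted cycles\<close>

text \<open>
  The inverse of \<open>ends_of\<close> on adjacent vertices. The edge that closes the ring joins \<open>17\<close>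
  to \<open>0\<close> and is number \<open>17\<close>, the larger of its ends, unlike the other ring edges.
\<close>

definition edge_between :: "nat \<Rightarrow> nat \<Rightarrow> nat" where
  "edge_between u v = (let m = min u v; M = max u v in
     if M \<ge> 18 then 18 + 2 * (m div 3) + m mod 3 else if M = Suc m then m else M)"

lemma is_cycle_successors:
  assumes "vs \<noteq> []" "distinct vs" "set vs \<subseteq> verts G"
    and "es = map2 f vs (rotate1 vs)" "distinct es" "set es \<subseteq> edges G"
    and "\<forall>(u, v) \<in> set (zip vs (rotate1 vs)). ends G (f u v) = {u, v}"
  shows "is_cycle G (vs, es)"
proof -
  have "ends G (es ! i) = {vs ! i, vs ! (Suc i mod length vs)}" if "i < length vs" for i
  proof -
    have "(vs ! i, rotate1 vs ! i) \<in> set (zip vs (rotate1 vs))"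
      using that by (auto simp: in_set_zip)
    then show ?thesis
      using assms(4,7) that by (auto simp: nth_rotate1)
  qed
  then show ?thesis using assms by (auto simp: is_cycle_def)
qed

text \<open>
  The vertices met on the way along the edge of $K_{3,3}$ from \<open>i\<close> to \<open>j\<close>, starting at a corner
  of \<open>i\<close> and ending at a corner of \<open>j\<close>; a diagonal consists of one vertex, which is a corner of
  both. Since all corners of a node are adjacent, the concatenation of the crossings
  along a cycle of $K_{3,3}$ is a cycle again.
\<close>

definition crossing :: "nat \<Rightarrow> nat \<Rightarrow> nat list" where
  "crossing i j =
    (if j = Suc i mod 6 then [3 * i + 1, 3 * i + 2, 3 * j]
     else if i = Suc j mod 6 then [3 * i, 3 * j + 2, 3 * j + 1]
     else [18 + i mod 3])"

definition lift_cycle :: "nat list \<Rightarrow> nat list" where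
  "lift_cycle xs = concat (map2 crossing xs (rotate1 xs))"

text \<open>
  The nine \<open>4\<close>-cycles and the six hexagons of $K_{3,3}$, alternating between even and odd nodes.
\<close>

definition K33_cycles :: "nat list list" where
  "K33_cycles =
    [[a, x, b, y]. (a, b) \<leftarrow> [(0, 2), (0, 4), (2, 4)], (x, y) \<leftarrow> [(1, 3), (1, 5), (3, 5)]] @
    [[0, x, 2, y, 4, z]. (x, y, z) \<leftarrow>
      [(1, 3, 5), (1, 5, 3), (3, 1, 5), (3, 5, 1), (5, 1, 3), (5, 3, 1)]]"

text \<open>
  The edge of $K_{3,3}$ that a vertex of the graph blocks. Hexagon edges are numbered
  \<open>0\<close> to \<open>5\<close> by their first node, diagonals \<open>6\<close> to \<open>8\<close>; a corner \<open>3 * i\<close> belongs to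
  the hexagon edge that arrives at \<open>i\<close>.
\<close>

definition K33_edge :: "nat \<Rightarrow> nat" where
  "K33_edge w = (if w < 18 then if w mod 3 = 0 then (w div 3 + 5) mod 6 else w div 3 else w - 12)"

lemma lift_cycle_S_cycle:
  assumes "xs \<in> set K33_cycles"
  shows "\<exists>es. is_S_cycle inflated_K33 ring_roots (lift_cycle xs, es)"
proof -
  have "\<forall>xs \<in> set K33_cycles. let vs = lift_cycle xs; es = map2 edge_between vs (rotate1 vs) in
      vs \<noteq> [] \<and> distinct vs \<and> (\<forall>v \<in> set vs. v < 21) \<and> distinct es \<and> (\<forall>e \<in> set es. e < 30) \<and>
      (\<forall>(u, v) \<in> set (zip vs (rotate1 vs)). ends_of (edge_between u v) = {u, v}) \<and>
      (\<exists>v \<in> set vs. v \<in> set [2, 5, 8, 11, 14, 17])"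
    by code_simp
  then have *: "lift_cycle xs \<noteq> []" "distinct (lift_cycle xs)" "set (lift_cycle xs) \<subseteq> {..<21}"
    "distinct (map2 edge_between (lift_cycle xs) (rotate1 (lift_cycle xs)))"
    "set (map2 edge_between (lift_cycle xs) (rotate1 (lift_cycle xs))) \<subseteq> {..<30}"
    "\<forall>(u, v) \<in> set (zip (lift_cycle xs) (rotate1 (lift_cycle xs))). ends_of (edge_between u v) = {u, v}"
    "set (lift_cycle xs) \<inter> ring_roots \<noteq> {}"
    using assms unfolding Let_def ring_roots_def by (auto 0 3)
  show ?thesis
    using is_cycle_successors[of "lift_cycle xs" inflated_K33 _ edge_between, OF _ _ _ refl] *
    by (auto simp: is_S_cycle_def cycle_verts_def simp del: set_map)
qed

text \<open>
  Six edges on six nodes cannot form a forest, so some cycle of $K_{3,3}$ survives the removal of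
  three edges \<open>a\<close>, \<open>b\<close>, \<open>c\<close>. Here it is found by running through all triples; the
  survivor is expressed by its lift, none of whose vertices belongs to a removed edge.
\<close>

lemma K33_minus_three_edges:
  assumes "a < 9" "b < 9" "c < 9"
  shows "\<exists>xs \<in> set K33_cycles. \<forall>w \<in> set (lift_cycle xs). K33_edge w \<notin> {a, b, c}"
proof -
  have "let Ls = map (\<lambda>xs. remdups (map K33_edge (lift_cycle xs))) K33_cycles in
      \<forall>a \<in> set [0..<9]. \<forall>b \<in> set [0..<9]. \<forall>c \<in> set [0..<9].
        \<exists>es \<in> set Ls. a \<notin> set es \<and> b \<notin> set es \<and> c \<notin> set es"
    by code_simp
  then have "\<exists>xs \<in> set K33_cycles. {a, b, c} \<inter> K33_edge ` set (lift_cycle xs) = {}"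
    using assms by (simp add: Let_def)
  then show ?thesis by blast
qed

text \<open>
  The lift of a surviving cycle avoids every vertex that belongs to one of the three edges, and
  in particular a given set of at most three vertices.
\<close>

lemma S_cycle_hitting_set_card:
  assumes "S_cycle_hitting_set inflated_K33 ring_roots T"
  shows "card T \<ge> 4"
proof (rule ccontr)
  assume "\<not> card T \<ge> 4"
  have T: "T \<subseteq> {..<21}" "finite T"
    using assms finite_subset by (auto simp: S_cycle_hitting_set_def)
  have "card (K33_edge ` T) \<le> 3"
    using card_image_le[OF T(2), of K33_edge] \<open>\<not> card T \<ge> 4\<close> by linarith
  moreover have "K33_edge ` T \<subseteq> {..<9}"
    using T by (auto simp: K33_edge_def)
  ultimately obtain B where B: "K33_edge ` T \<subseteq> B" "B \<subseteq> {..<9}" "card B = 3"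
    using exists_subset_between[of "K33_edge ` T" 3 "{..<9}"] by auto
  then obtain a b c where abc: "B = {a, b, c}"
    by (auto simp: card_3_iff)
  then obtain xs where xs: "xs \<in> set K33_cycles"
    "\<forall>w \<in> set (lift_cycle xs). K33_edge w \<notin> {a, b, c}"
    using K33_minus_three_edges[of a b c] B(2) abc by auto
  obtain es where "is_S_cycle inflated_K33 ring_roots (lift_cycle xs, es)"
    using lift_cycle_S_cycle[OF xs(1)] by blast
  then have "T \<inter> set (lift_cycle xs) \<noteq> {}"
    using assms by (auto simp: S_cycle_hitting_set_def cycle_verts_def)
  then show False using xs(2) B(1) abc by blast
qed

theorem theorem1p1:
  "\<exists>(G :: (nat, nat) multigraph) (S :: nat set).
     rooted_graph G S \<and> card (verts G) = 21 \<and> mu G S = 1 \<and> tau G S \<ge> 4"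
proof (intro exI conjI)
  let ?G = inflated_K33 and ?S = ring_roots
  have fin: "finite (verts ?G)" by simp
  show "rooted_graph ?G ?S" by (rule rooted_graph_inflated_K33)
  show "card (verts ?G) = 21" by simp
  show "mu ?G ?S = 1"
    unfolding mu_def
  proof (rule Max_eqI[OF mu_range(1)[OF fin]])
    fix n assume "n \<in> {card P |P. S_cycle_packing ?G ?S P}"
    then obtain P where P: "n = card P" "S_cycle_packing ?G ?S P" by blast
    then have "C = D" if "C \<in> P" "D \<in> P" for C D
      using that S_cycles_intersect[of C D] unfolding S_cycle_packing_def by blast
    moreover have "finite P" using P by (simp add: S_cycle_packing_def)
    ultimately show "n \<le> 1" using P(1) by (simp add: card_le_Suc0_iff_eq)
  next
    have "[0, 1, 2, 3] \<in> set K33_cycles" by (simp add: K33_cycles_def)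
    then obtain C where "is_S_cycle ?G ?S C" using lift_cycle_S_cycle by blast
    then have "S_cycle_packing ?G ?S {C}" by (simp add: S_cycle_packing_def)
    then show "1 \<in> {card P |P. S_cycle_packing ?G ?S P}" by force
  qed
  show "tau ?G ?S \<ge> 4"
    unfolding tau_def using tau_range[OF fin] S_cycle_hitting_set_card
    by (subst Min_ge_iff) auto
qed

end
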